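(* Let $C\subset[0,1]$ be the middle third Cantor set, let $C\times C\subset\mathbb{R}^2$ be its Cartesian product with itself, and let $s=\dim_H(C\times C)=\log_3 4$. Then the $s$-dimensional Hausdorff measure of $C\times C$ satisfies $$H^s(C\times C)\le 1.502483.$$
   Context: The middle third Cantor set $C$ is the unique nonempty compact set with $C=f_1(C)\cup f_2(C)$, where $f_1(x)=x/3$ and $f_2(x)=(x+2)/3$. The plane $\mathbb{R}^2$ carries the Euclidean metric and $|U|$ denotes the diameter of a set $U$. Hausdorff measure is taken without any normalizing constant: for $\delta>0$, $H^s_\delta(E)=\inf\sum_{i=1}^\infty |U_i|^s$, the infimum being over all countable covers $E\subset\bigcup_i U_i$ with $0<|U_i|\le\delta$, and $H^s(E)=\lim_{\delta\to0^+}H^s_\delta(E)$. *)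

theory Defs
  imports "HOL-Analysis.Analysis"
begin

definition cantor_map1 :: "real \<Rightarrow> real" where
  "cantor_map1 x = x / 3"

definition cantor_map2 :: "real \<Rightarrow> real" where
  "cantor_map2 x = (x + 2) / 3"

definition is_cantor_set :: "real set \<Rightarrow> bool" where
  "is_cantor_set C \<longleftrightarrow>
     C \<noteq> {} \<and> compact C \<and> C = cantor_map1 ` C \<union> cantor_map2 ` C"

definition cantor_set :: "real set" where
  "cantor_set = (THE C. is_cantor_set C)"

text \<open>
  \<^const>\<open>diameter\<close> is real-valued and unspecified on unbounded sets, so boundedness of the
  covering sets is required separately. The value is \<open>\<infinity>\<close> if there is no such cover.
\<close>

definition hausdorff_pre :: "real \<Rightarrow> real \<Rightarrow> 'a::metric_space set \<Rightarrow> ennreal" where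
  "hausdorff_pre s \<delta> E =
     Inf {(\<Sum>i. ennreal (diameter (U i) powr s)) | U :: nat \<Rightarrow> 'a set.
            E \<subseteq> (\<Union>i. U i) \<and>
            (\<forall>i. bounded (U i) \<and> 0 < diameter (U i) \<and> diameter (U i) \<le> \<delta>)}"

definition hausdorff_measure :: "real \<Rightarrow> 'a::metric_space set \<Rightarrow> ennreal" where
  "hausdorff_measure s E = Lim (at_right 0) (\<lambda>\<delta>. hausdorff_pre s \<delta> E)"

text \<open>
  The set below contains every \<open>s > DIM('a)\<close> and is bounded below by \<open>0\<close>, so the real
  infimum is meaningful.
\<close>

definition hausdorff_dim :: "'a::euclidean_space set \<Rightarrow> real" where
  "hausdorff_dim E = Inf {s. 0 \<le> s \<and> hausdorff_measure s E = 0}"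


text \<open>The limit defining the Hausdorff measure exists, and it is a supremum.\<close>

lemma hausdorff_pre_antimono:
  assumes "\<delta> \<le> \<delta>'"
  shows "hausdorff_pre s \<delta>' E \<le> hausdorff_pre s \<delta> E"
  unfolding hausdorff_pre_def
  by (rule Inf_superset_mono) (use assms order_trans in blast)

lemma hausdorff_pre_tendsto_SUP:
  "((\<lambda>\<delta>. hausdorff_pre s \<delta> E) \<longlongrightarrow> (SUP \<delta>\<in>{0<..}. hausdorff_pre s \<delta> E)) (at_right 0)"
proof (rule order_tendstoI)
  fix a assume "a < (SUP \<delta>\<in>{0<..}. hausdorff_pre s \<delta> E)"
  then obtain d where d: "d > 0" "a < hausdorff_pre s d E"
    unfolding less_SUP_iff by auto
  have "eventually (\<lambda>\<delta>::real. \<delta> < d) (at_right 0)"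
    using d(1) eventually_at_right_field by blast
  then show "\<forall>\<^sub>F \<delta> in at_right 0. a < hausdorff_pre s \<delta> E"
  proof eventually_elim
    case (elim \<delta>)
    then have "hausdorff_pre s d E \<le> hausdorff_pre s \<delta> E"
      by (intro hausdorff_pre_antimono) simp
    with d(2) show ?case
      by (rule less_le_trans)
  qed
next
  fix a assume a: "(SUP \<delta>\<in>{0<..}. hausdorff_pre s \<delta> E) < a"
  show "\<forall>\<^sub>F \<delta> in at_right 0. hausdorff_pre s \<delta> E < a"
    using eventually_at_right_less[of "0::real"]
  proof eventually_elim
    case (elim \<delta>)
    then have "hausdorff_pre s \<delta> E \<le> (SUP \<delta>\<in>{0<..}. hausdorff_pre s \<delta> E)"
      by (intro SUP_upper) simp
    then show ?case
      using a by (rule le_less_trans)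
  qed
qed

lemma hausdorff_measure_eq_SUP:
  "hausdorff_measure s E = (SUP \<delta>\<in>{0<..}. hausdorff_pre s \<delta> E)"
  unfolding hausdorff_measure_def
  by (rule tendsto_Lim[OF _ hausdorff_pre_tendsto_SUP]) simp


text \<open>Existence and uniqueness of the Cantor set.\<close>

lemma is_cantor_setD:
  assumes "is_cantor_set C"
  shows "compact C" "C \<noteq> {}" "C = cantor_map1 ` C \<union> cantor_map2 ` C"
  by (rule assms[unfolded is_cantor_set_def, THEN conjunct2, THEN conjunct1]
           assms[unfolded is_cantor_set_def, THEN conjunct1]
           assms[unfolded is_cantor_set_def, THEN conjunct2, THEN conjunct2])+

lemma is_cantor_set_subset:
  assumes A: "is_cantor_set A" and B: "is_cantor_set B"
  shows "A \<subseteq> B"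
proof -
  have cA: "compact A" "A \<noteq> {}" and eA: "A = cantor_map1 ` A \<union> cantor_map2 ` A"
    by (rule is_cantor_setD[OF A])+
  have cB: "closed B" "B \<noteq> {}" and eB: "B = cantor_map1 ` B \<union> cantor_map2 ` B"
    by (rule compact_imp_closed is_cantor_setD[OF B])+
  have "continuous_on A (\<lambda>x. infdist x B)"
    by (intro continuous_intros)
  then obtain a where a: "a \<in> A" "\<And>x. x \<in> A \<Longrightarrow> infdist x B \<le> infdist a B"
    using continuous_attains_sup[OF cA] by blast
  obtain a' f where f: "f = cantor_map1 \<or> f = cantor_map2" and a': "a' \<in> A" "a = f a'"
    using a(1) eA by blast
  obtain b where b: "b \<in> B" "infdist a' B = dist a' b"
    using infdist_attains_inf[OF cB] by blast
  have "f b \<in> B"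
    using f b(1) eB by blast
  then have "infdist a B \<le> dist (f a') (f b)"
    unfolding a'(2) by (rule infdist_le)
  also have "\<dots> = infdist a' B / 3"
    using f unfolding b(2) by (auto simp: dist_real_def cantor_map1_def cantor_map2_def abs_if field_simps)
  also have "\<dots> \<le> infdist a B / 3"
    using a(2)[OF a'(1)] by simp
  finally have "infdist a B \<le> 0"
    by simp
  then have "infdist x B = 0" if "x \<in> A" for x
    using a(2)[OF that] infdist_nonneg[of x B] by linarith
  then show ?thesis
    using in_closed_iff_infdist_zero[OF cB] by blast
qed

lemma is_cantor_set_exists: "\<exists>C. is_cantor_set C \<and> C \<subseteq> {0..1}"
proof -
  define F where "F X = cantor_map1 ` X \<union> cantor_map2 ` X" for X
  define K where "K n = (F ^^ n) {0..1}" for n :: nat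
  have K0: "K 0 = {0..1}" and KS: "K (Suc n) = F (K n)" for n
    by (simp_all add: K_def)
  have mono: "F X \<subseteq> F Y" if "X \<subseteq> Y" for X Y
    using that unfolding F_def by blast
  have "F {0..1} \<subseteq> {0..1}"
    by (auto simp: F_def cantor_map1_def cantor_map2_def)
  then have dec1: "K (Suc n) \<subseteq> K n" for n
  proof (induction n)
    case (Suc n)
    then show ?case using mono[OF Suc.IH] by (simp only: KS)
  qed (simp add: KS K0)
  have sub: "K n \<subseteq> {0..1}" for n
    using lift_Suc_antimono_le[of K 0 n, OF dec1] K0 by simp
  have "continuous_on X cantor_map1" "continuous_on X cantor_map2" for X
    unfolding cantor_map1_def cantor_map2_def by (auto intro!: continuous_intros)
  then have "compact (F X)" if "compact X" for X
    unfolding F_def using that by (intro compact_Un compact_continuous_image) auto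
  then have comp: "compact (K n)" for n
    by (induction n) (auto simp: K0 KS)
  have zero: "0 \<in> K n" for n
  proof (induction n)
    case (Suc n)
    then have "cantor_map1 0 \<in> K (Suc n)" unfolding KS F_def by blast
    then show ?case by (simp add: cantor_map1_def)
  qed (simp add: K0)
  define C where "C = (\<Inter>n. K n)"
  have "C \<subseteq> K 0"
    unfolding C_def by blast
  have "compact C"
    unfolding C_def by (rule compact_Inter) (use comp in auto)
  have "F C \<subseteq> C"
  proof -
    have "F C \<subseteq> K (Suc n)" for n
      unfolding KS C_def by (rule mono) blast
    then show ?thesis
      using dec1 unfolding C_def by blast
  qed
  moreover have "C \<subseteq> F C"
  proof
    fix x assume x: "x \<in> C"
    have "3 * x \<in> K n" if "x \<le> 1/2" for n
    proof -
      have "x \<in> F (K n)" using x unfolding C_def KS[symmetric] by blast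
      then obtain y where y: "y \<in> K n" "x = y / 3 \<or> x = (y + 2) / 3"
        unfolding F_def cantor_map1_def cantor_map2_def by blast
      moreover have "0 \<le> y" "y \<le> 1"
        using y(1) sub[of n] by auto
      ultimately have "y = 3 * x"
        using that by auto
      then show ?thesis
        using y(1) by simp
    qed
    moreover have "3 * x - 2 \<in> K n" if "x > 1/2" for n
    proof -
      have "x \<in> F (K n)" using x unfolding C_def KS[symmetric] by blast
      then obtain y where y: "y \<in> K n" "x = y / 3 \<or> x = (y + 2) / 3"
        unfolding F_def cantor_map1_def cantor_map2_def by blast
      moreover have "0 \<le> y" "y \<le> 1"
        using y(1) sub[of n] by auto
      ultimately have "y = 3 * x - 2"
        using that by auto
      then show ?thesis
        using y(1) by simp
    qed
    moreover have "x = cantor_map1 (3 * x)" "x = cantor_map2 (3 * x - 2)"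
      by (simp_all add: cantor_map1_def cantor_map2_def)
    ultimately have "x \<in> cantor_map1 ` C \<or> x \<in> cantor_map2 ` C"
      unfolding C_def by (cases "x \<le> 1/2") (metis INT_I image_eqI, metis INT_I image_eqI not_le)
    then show "x \<in> F C"
      unfolding F_def by blast
  qed
  ultimately have "C = F C" by blast
  moreover have "0 \<in> C"
    using zero unfolding C_def by blast
  then have "C \<noteq> {}" by blast
  ultimately have "is_cantor_set C"
    unfolding is_cantor_set_def F_def by (intro conjI \<open>compact C\<close>)
  then show ?thesis
    using \<open>C \<subseteq> K 0\<close> K0 by blast
qed

lemma is_cantor_set_cantor_set: "is_cantor_set cantor_set"
  unfolding cantor_set_def
  by (rule theI') (metis is_cantor_set_exists is_cantor_set_subset subset_antisym)

lemma cantor_set_subset: "cantor_set \<subseteq> {0..1}"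
  by (metis is_cantor_set_cantor_set is_cantor_set_exists is_cantor_set_subset order_trans)

end

theory Submission
  imports Defs
begin

text \<open>
  Write \<open>E\<close> for the square of the Cantor set and \<open>s = log 3 4\<close>. The unit square, of diameter
  \<open>sqrt 2\<close>, gives the trivial bound \<open>sqrt 2 powr s\<close>, about \<open>1.5486\<close>. Give each cell of level \<open>k\<close> the
  mass \<open>1 / 4 ^ k\<close>. Cutting off small pieces at the four corners reduces the power of the diameter
  by a larger factor than the mass. Let \<open>B\<close> be the disc
  around the centre of the square with diameter \<open>d = sqrt 100258 / 243\<close>. The part of \<open>E\<close> outside
  \<open>B\<close> lies in four cells of level 3 and eight cells of level 5, which carry the fraction
  \<open>4/64 + 8/1024 = 9/128\<close> of the mass (\<open>cantor_square_subset\<close>). These cells are scaled copies of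
  \<open>E\<close>, and scaling by \<open>1 / 3 ^ k\<close> multiplies \<open>s\<close>-dimensional premeasures by \<open>1 / 4 ^ k\<close>. Hence
  the premeasure \<open>h\<close> of \<open>E\<close> at scale 2 satisfies \<open>h \<le> d powr s + 9/128 * h\<close>, that is,
  \<open>h \<le> 128/119 * d powr s\<close>, which is about \<open>1.50217\<close> (\<open>hausdorff_pre_cantor_square_le\<close>).

  The set \<open>E\<close> is a union of \<open>4 ^ m\<close> copies of ratio \<open>1 / 3 ^ m\<close>, so its premeasure at scale
  \<open>2 / 3 ^ m\<close> is again at most \<open>h\<close>; letting \<open>m\<close> grow bounds the Hausdorff measure by \<open>h\<close>
  (\<open>hausdorff_measure_cantor_square_le\<close>). The same rescaling with an exponent \<open>t > s\<close> shows that
  the \<open>t\<close>-dimensional measure vanishes. For \<open>t \<le> s\<close> it is positive, because a set of diameter less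
  than \<open>1 / 3 ^ k\<close> meets at most one cell of level \<open>k\<close>
  (\<open>hausdorff_pre_cantor_square_ge\<close>). Together these give the dimension.
\<close>

section \<open>Hausdorff premeasures\<close>

abbreviation fine_sets :: "real \<Rightarrow> (nat \<Rightarrow> 'a::metric_space set) \<Rightarrow> bool" where
  "fine_sets \<delta> U \<equiv> \<forall>i. bounded (U i) \<and> 0 < diameter (U i) \<and> diameter (U i) \<le> \<delta>"

lemma hausdorff_pre_le:
  assumes "E \<subseteq> (\<Union>i. U i)"
    and "fine_sets \<delta> U"
  shows "hausdorff_pre s \<delta> E \<le> (\<Sum>i. ennreal (diameter (U i) powr s))"
  unfolding hausdorff_pre_def by (rule Inf_lower) (use assms in blast)

lemma hausdorff_pre_greatest:
  assumes "\<And>U. E \<subseteq> (\<Union>i. U i) \<Longrightarrow>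
      fine_sets \<delta> U \<Longrightarrow>
      z \<le> (\<Sum>i. ennreal (diameter (U i) powr s))"
  shows "z \<le> hausdorff_pre s \<delta> E"
  unfolding hausdorff_pre_def by (rule Inf_greatest) (use assms in blast)

lemma hausdorff_pre_cover:
  assumes "hausdorff_pre s \<delta> E < z"
  obtains U where "E \<subseteq> (\<Union>i. U i)"
    "fine_sets \<delta> U"
    "(\<Sum>i. ennreal (diameter (U i) powr s)) < z"
  using assms unfolding hausdorff_pre_def Inf_less_iff by blast

lemma hausdorff_pre_mono:
  "A \<subseteq> B \<Longrightarrow> hausdorff_pre s \<delta> A \<le> hausdorff_pre s \<delta> B"
  by (rule hausdorff_pre_greatest, rule hausdorff_pre_le) auto

text \<open>
  Admissible covers are infinite sequences of sets of positive diameter, so a finite cover has to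
  be padded before it can be used. Balls whose diameters decrease geometrically after raising to
  the power \<open>s\<close> do this at arbitrarily small cost.
\<close>

lemma negligible_cover:
  fixes \<eta> \<delta> s :: real
  assumes "0 < s" "0 < \<delta>" "0 < \<eta>"
  obtains T :: "nat \<Rightarrow> 'a::euclidean_space set" where
    "fine_sets \<delta> T"
    "(\<Sum>i. ennreal (diameter (T i) powr s)) \<le> ennreal \<eta>"
proof -
  define e where "e i = min \<delta> ((\<eta> * (1/2)^Suc i) powr (1/s))" for i :: nat
  have e: "0 < e i" "e i \<le> \<delta>" for i using assms by (auto simp: e_def)
  define T where "T i = cball (0 :: 'a) (e i / 2)" for i
  have d: "diameter (T i) = e i" for i
    using e(1)[of i] by (simp add: T_def)
  have le: "e i powr s \<le> \<eta> * (1/2)^Suc i" for i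
  proof -
    have "e i powr s \<le> ((\<eta> * (1/2)^Suc i) powr (1/s)) powr s"
      using e(1)[of i] assms by (intro powr_mono2) (auto simp: e_def)
    then show ?thesis using assms by (simp add: powr_powr)
  qed
  have "(\<lambda>i. \<eta> * (1/2)^Suc i) sums (\<eta> * 1)"
    by (rule sums_mult) (rule power_half_series)
  then have "(\<Sum>i. ennreal (\<eta> * (1/2)^Suc i)) = ennreal \<eta>"
    using assms by (intro suminf_ennreal_eq) auto
  moreover have "(\<Sum>i. ennreal (e i powr s)) \<le> (\<Sum>i. ennreal (\<eta> * (1/2)^Suc i))"
    by (intro suminf_le ennreal_leI le) auto
  ultimately have "(\<Sum>i. ennreal (diameter (T i) powr s)) \<le> ennreal \<eta>"
    by (simp only: d)
  moreover have "fine_sets \<delta> T"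
    unfolding d using e by (simp add: T_def)
  ultimately show thesis by (rule that[rotated])
qed

lemma hausdorff_pre_empty:
  assumes "0 < s" "0 < \<delta>"
  shows "hausdorff_pre s \<delta> ({} :: 'a::euclidean_space set) = 0"
proof -
  have "hausdorff_pre s \<delta> ({} :: 'a set) \<le> 0"
  proof (rule ennreal_le_epsilon)
    fix \<eta> :: real assume "0 < \<eta>"
    obtain T :: "nat \<Rightarrow> 'a set" where T:
      "fine_sets \<delta> T"
      "(\<Sum>i. ennreal (diameter (T i) powr s)) \<le> ennreal \<eta>"
      by (rule negligible_cover[OF assms \<open>0 < \<eta>\<close>])
    show "hausdorff_pre s \<delta> ({} :: 'a set) \<le> 0 + ennreal \<eta>"
      using order_trans[OF hausdorff_pre_le[OF empty_subsetI T(1)] T(2)] by simp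
  qed
  then show ?thesis by simp
qed

lemma hausdorff_pre_countable_UN:
  "hausdorff_pre s \<delta> (\<Union>i. A i) \<le> (\<Sum>i. hausdorff_pre s \<delta> (A i))"
proof (rule ennreal_le_epsilon)
  fix \<eta> :: real assume \<eta>: "0 < \<eta>" and fin: "(\<Sum>i. hausdorff_pre s \<delta> (A i)) < top"
  have "\<exists>U. A i \<subseteq> (\<Union>j. U j) \<and>
      fine_sets \<delta> U \<and>
      (\<Sum>j. ennreal (diameter (U j) powr s)) \<le> hausdorff_pre s \<delta> (A i) + ennreal (\<eta> * (1/2)^Suc i)"
    for i
  proof -
    have "hausdorff_pre s \<delta> (A i) < top"
      using fin by (metis ennreal_suminf_lessD)
    then have "hausdorff_pre s \<delta> (A i) < hausdorff_pre s \<delta> (A i) + ennreal (\<eta> * (1/2)^Suc i)"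
      using \<eta> ennreal_add_left_cancel_less[of "hausdorff_pre s \<delta> (A i)" 0] by simp
    then obtain U where "A i \<subseteq> (\<Union>j. U j)"
      "fine_sets \<delta> U"
      "(\<Sum>j. ennreal (diameter (U j) powr s)) < hausdorff_pre s \<delta> (A i) + ennreal (\<eta> * (1/2)^Suc i)"
      by (rule hausdorff_pre_cover)
    then show ?thesis by (intro exI[of _ U]) (simp add: less_imp_le)
  qed
  then obtain U where U: "\<And>i. A i \<subseteq> (\<Union>j. U i j)"
      "\<And>i. fine_sets \<delta> (U i)"
      "\<And>i. (\<Sum>j. ennreal (diameter (U i j) powr s))
          \<le> hausdorff_pre s \<delta> (A i) + ennreal (\<eta> * (1/2)^Suc i)"
    by metis
  define V where "V k = case_prod U (prod_decode k)" for k
  have "(\<Union>i. A i) \<subseteq> (\<Union>k. V k)"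
  proof
    fix x assume "x \<in> (\<Union>i. A i)"
    then obtain i j where "x \<in> U i j" using U(1) by blast
    then have "x \<in> V (prod_encode (i, j))" by (simp add: V_def)
    then show "x \<in> (\<Union>k. V k)" by blast
  qed
  then have "hausdorff_pre s \<delta> (\<Union>i. A i) \<le> (\<Sum>k. ennreal (diameter (V k) powr s))"
    by (rule hausdorff_pre_le) (simp add: V_def U(2) split: prod.split)
  also have "\<dots> = (\<Sum>i j. ennreal (diameter (U i j) powr s))"
    unfolding V_def
    by (rule suminf_ennreal_2dimen[where f = "\<lambda>p. ennreal (diameter (case_prod U p) powr s)"]) simp
  also have "\<dots> \<le> (\<Sum>i. hausdorff_pre s \<delta> (A i) + ennreal (\<eta> * (1/2)^Suc i))"
    by (intro suminf_le U(3)) auto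
  also have "\<dots> = (\<Sum>i. hausdorff_pre s \<delta> (A i)) + (\<Sum>i. ennreal (\<eta> * (1/2)^Suc i))"
    by (rule suminf_add[symmetric]) auto
  also have "(\<Sum>i. ennreal (\<eta> * (1/2)^Suc i)) = ennreal (\<eta> * 1)"
    using \<eta> by (intro suminf_ennreal_eq sums_mult power_half_series) auto
  finally show "hausdorff_pre s \<delta> (\<Union>i. A i) \<le> (\<Sum>i. hausdorff_pre s \<delta> (A i)) + ennreal \<eta>"
    by simp
qed

lemma hausdorff_pre_Un:
  fixes A B :: "'a::euclidean_space set"
  assumes "0 < s" "0 < \<delta>"
  shows "hausdorff_pre s \<delta> (A \<union> B) \<le> hausdorff_pre s \<delta> A + hausdorff_pre s \<delta> B"
proof -
  define S where "S i = (if i = 0 then A else if i = 1 then B else {})" for i :: nat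
  have "A \<union> B = (\<Union>i. S i)" by (auto simp: S_def split: if_splits)
  also have "hausdorff_pre s \<delta> \<dots> \<le> (\<Sum>i. hausdorff_pre s \<delta> (S i))"
    by (rule hausdorff_pre_countable_UN)
  also have "\<dots> = (\<Sum>i\<in>{0,1}. hausdorff_pre s \<delta> (S i))"
    by (rule suminf_finite) (auto simp: S_def hausdorff_pre_empty[OF assms])
  finally show ?thesis by (simp add: S_def)
qed

lemma hausdorff_pre_UN:
  fixes A :: "'i \<Rightarrow> 'a::euclidean_space set"
  assumes "0 < s" "0 < \<delta>" "finite I"
  shows "hausdorff_pre s \<delta> (\<Union>i\<in>I. A i) \<le> (\<Sum>i\<in>I. hausdorff_pre s \<delta> (A i))"
  using assms(3)
proof (induction I rule: finite_induct)
  case empty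
  then show ?case by (simp add: hausdorff_pre_empty[OF assms(1,2)])
next
  case (insert i I)
  have "hausdorff_pre s \<delta> (\<Union>j\<in>insert i I. A j)
      \<le> hausdorff_pre s \<delta> (A i) + hausdorff_pre s \<delta> (\<Union>j\<in>I. A j)"
    using hausdorff_pre_Un[OF assms(1,2)] by simp
  also have "\<dots> \<le> hausdorff_pre s \<delta> (A i) + (\<Sum>j\<in>I. hausdorff_pre s \<delta> (A j))"
    by (intro add_left_mono insert.IH)
  finally show ?case using insert.hyps by simp
qed

lemma hausdorff_pre_diameter:
  fixes A :: "'a::euclidean_space set"
  assumes s: "0 < s" and A: "bounded A" "0 < diameter A" "diameter A \<le> \<delta>"
  shows "hausdorff_pre s \<delta> A \<le> ennreal (diameter A powr s)"
proof (rule ennreal_le_epsilon)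
  fix \<eta> :: real assume "0 < \<eta>"
  have \<delta>: "0 < \<delta>" using A by simp
  obtain T :: "nat \<Rightarrow> 'a set" where
    T: "fine_sets \<delta> T"
      "(\<Sum>i. ennreal (diameter (T i) powr s)) \<le> ennreal \<eta>"
    by (rule negligible_cover[OF s \<delta> \<open>0 < \<eta>\<close>])
  define U where "U i = (if i = 0 then A else T i)" for i
  have "A \<subseteq> (\<Union>i. U i)" by (auto simp: U_def)
  then have "hausdorff_pre s \<delta> A \<le> (\<Sum>i. ennreal (diameter (U i) powr s))"
    by (rule hausdorff_pre_le) (use A T(1) in \<open>auto simp: U_def\<close>)
  also have "\<dots> \<le> (\<Sum>i. (if i = 0 then ennreal (diameter A powr s) else 0)
      + ennreal (diameter (T i) powr s))"
    by (intro suminf_le) (auto simp: U_def)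
  also have "\<dots> = (\<Sum>i::nat. if i = 0 then ennreal (diameter A powr s) else 0)
      + (\<Sum>i. ennreal (diameter (T i) powr s))"
    by (rule suminf_add[symmetric]) auto
  also have "(\<Sum>i::nat. if i = 0 then ennreal (diameter A powr s) else 0)
      = ennreal (diameter A powr s)"
    by (subst suminf_finite[of "{0}"]) auto
  also have "ennreal (diameter A powr s) + (\<Sum>i. ennreal (diameter (T i) powr s))
      \<le> ennreal (diameter A powr s) + ennreal \<eta>"
    by (intro add_left_mono T(2))
  finally show "hausdorff_pre s \<delta> A \<le> ennreal (diameter A powr s) + ennreal \<eta>" .
qed

lemma diameter_similarity:
  fixes f :: "'a::real_normed_vector \<Rightarrow> 'b::real_normed_vector"
  assumes f: "\<And>x y. dist (f x) (f y) = c * dist x y" and c: "0 < c" and A: "bounded A"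
  shows "bounded (f ` A)" "diameter (f ` A) = c * diameter A"
proof -
  have le: "dist (f x) (f y) \<le> c * diameter A" if "x \<in> A" "y \<in> A" for x y
    using diameter_bounded_bound[OF A that] f c by simp
  show b: "bounded (f ` A)"
    unfolding bounded_two_points using le by blast
  show "diameter (f ` A) = c * diameter A"
  proof (cases "A = {}")
    case True then show ?thesis by simp
  next
    case False
    have "diameter (f ` A) \<le> c * diameter A"
      using False le by (intro diameter_le) (auto simp: dist_norm)
    moreover have "diameter A \<le> diameter (f ` A) / c"
    proof -
      have "dist x y \<le> diameter (f ` A) / c" if "x \<in> A" "y \<in> A" for x y
        using diameter_bounded_bound[OF b imageI[OF that(1)] imageI[OF that(2)]] f c
        by (simp add: field_simps)
      then show ?thesis using False by (intro diameter_le) (auto simp: dist_norm)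
    qed
    ultimately show ?thesis using c by (simp add: field_simps)
  qed
qed

lemma hausdorff_pre_similarity:
  fixes f :: "'a::real_normed_vector \<Rightarrow> 'b::real_normed_vector"
  assumes f: "\<And>x y. dist (f x) (f y) = c * dist x y" and c: "0 < c"
  shows "hausdorff_pre s (c * \<delta>) (f ` E) \<le> ennreal (c powr s) * hausdorff_pre s \<delta> E"
proof -
  have one: "ennreal (c powr s) * ennreal (c powr - s) = 1"
    using c by (simp flip: ennreal_mult powr_add)
  have cancel: "ennreal (c powr s) * (ennreal (c powr - s) * x) = x"
      "ennreal (c powr - s) * (ennreal (c powr s) * x) = x" for x
    by (simp_all only: mult.assoc[symmetric] one one[unfolded mult.commute[of "ennreal (c powr s)"]] mult_1_left)
  have "ennreal (c powr - s) * hausdorff_pre s (c * \<delta>) (f ` E) \<le> hausdorff_pre s \<delta> E"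
  proof (rule hausdorff_pre_greatest)
    fix U assume U: "E \<subseteq> (\<Union>i. U i)"
      "fine_sets \<delta> U"
    have d: "bounded (f ` U i)" "diameter (f ` U i) = c * diameter (U i)" for i
      using diameter_similarity[OF f c, of "U i"] U(2) by auto
    have "hausdorff_pre s (c * \<delta>) (f ` E) \<le> (\<Sum>i. ennreal (diameter (f ` U i) powr s))"
      by (rule hausdorff_pre_le) (use U(1) in blast, use U(2) c in \<open>simp add: d\<close>)
    also have "\<dots> = (\<Sum>i. ennreal (c powr s) * ennreal (diameter (U i) powr s))"
      using U(2) c by (simp add: d powr_mult ennreal_mult less_imp_le)
    also have "\<dots> = ennreal (c powr s) * (\<Sum>i. ennreal (diameter (U i) powr s))"
      by simp
    finally have "ennreal (c powr - s) * hausdorff_pre s (c * \<delta>) (f ` E)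
        \<le> ennreal (c powr - s) * (ennreal (c powr s) * (\<Sum>i. ennreal (diameter (U i) powr s)))"
      by (rule mult_left_mono) simp
    then show "ennreal (c powr - s) * hausdorff_pre s (c * \<delta>) (f ` E)
        \<le> (\<Sum>i. ennreal (diameter (U i) powr s))"
      unfolding cancel .
  qed
  then have "ennreal (c powr s) * (ennreal (c powr - s) * hausdorff_pre s (c * \<delta>) (f ` E))
      \<le> ennreal (c powr s) * hausdorff_pre s \<delta> E"
    by (rule mult_left_mono) simp
  then show ?thesis
    unfolding cancel .
qed

section \<open>The Cantor set and its square\<close>

lemma cantor_set_eq: "cantor_set = cantor_map1 ` cantor_set \<union> cantor_map2 ` cantor_set"
  by (rule is_cantor_setD(3)[OF is_cantor_set_cantor_set])

lemma cantor_set_bounds: "x \<in> cantor_set \<Longrightarrow> 0 \<le> x \<and> x \<le> 1"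
  using cantor_set_subset by auto

lemma cantor_set_cases:
  assumes "x \<in> cantor_set"
  shows "x \<le> 1/3 \<and> 3 * x \<in> cantor_set \<or> 2/3 \<le> x \<and> 3 * x - 2 \<in> cantor_set"
proof -
  obtain y where y: "y \<in> cantor_set" "x = cantor_map1 y \<or> x = cantor_map2 y"
    using assms cantor_set_eq by blast
  then have "y = 3 * x \<and> x \<le> 1/3 \<or> y = 3 * x - 2 \<and> 2/3 \<le> x"
    using cantor_set_bounds[OF y(1)] by (auto simp: cantor_map1_def cantor_map2_def)
  then show ?thesis using y(1) by auto
qed

lemma cantor_set_map1: "x \<in> cantor_set \<Longrightarrow> cantor_map1 x \<in> cantor_set"
  and cantor_set_map2: "x \<in> cantor_set \<Longrightarrow> cantor_map2 x \<in> cantor_set"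
  using cantor_set_eq by blast+

text \<open>The least element \<open>a\<close> satisfies \<open>a \<le> a / 3\<close>.\<close>

lemma zero_in_cantor_set: "0 \<in> cantor_set"
proof -
  obtain a where a: "a \<in> cantor_set" "\<And>x. x \<in> cantor_set \<Longrightarrow> a \<le> x"
    using compact_attains_inf[OF is_cantor_setD(1,2)[OF is_cantor_set_cantor_set]] by blast
  have "a \<le> a / 3"
    using a(2)[OF cantor_set_map1[OF a(1)]] by (simp add: cantor_map1_def)
  then have "a = 0" using cantor_set_bounds[OF a(1)] by simp
  then show ?thesis using a(1) by simp
qed

text \<open>
  The reflection interchanges the two defining maps, so the reflected Cantor set satisfies the
  same fixed point equation and uniqueness applies.
\<close>

lemma cantor_set_reflect:
  assumes "x \<in> cantor_set"
  shows "1 - x \<in> cantor_set"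
proof -
  let ?R = "(\<lambda>x. 1 - x) ` cantor_set"
  have "compact ?R"
    by (intro compact_continuous_image continuous_intros is_cantor_setD(1) is_cantor_set_cantor_set)
  moreover have "?R \<noteq> {}" using assms by blast
  moreover have "?R = cantor_map1 ` ?R \<union> cantor_map2 ` ?R"
  proof -
    have swap: "1 - cantor_map1 x = cantor_map2 (1 - x)" "1 - cantor_map2 x = cantor_map1 (1 - x)"
      for x by (simp_all add: cantor_map1_def cantor_map2_def field_simps)
    have "?R = (\<lambda>x. 1 - x) ` (cantor_map1 ` cantor_set \<union> cantor_map2 ` cantor_set)"
      using cantor_set_eq by simp
    also have "\<dots> = cantor_map1 ` ?R \<union> cantor_map2 ` ?R"
      unfolding image_Un image_image swap by (rule Un_commute)
    finally show ?thesis .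
  qed
  ultimately have "is_cantor_set ?R" unfolding is_cantor_set_def by blast
  then have "?R \<subseteq> cantor_set" by (rule is_cantor_set_subset[OF _ is_cantor_set_cantor_set])
  then show ?thesis using assms by blast
qed

lemma powr_log_3_4: "(1 / 3 ^ k) powr log 3 4 = (1 / 4 ^ k :: real)"
proof -
  have "((3::real) ^ k) powr log 3 4 = (3 powr real k) powr log 3 4"
    by (simp add: powr_realpow)
  also have "\<dots> = (3 powr log 3 4) powr real k"
    by (simp only: powr_powr mult.commute)
  also have "\<dots> = 4 ^ k"
    by (simp add: powr_realpow)
  finally have "((3::real) ^ k) powr log 3 4 = 4 ^ k" .
  then show ?thesis by (simp add: powr_divide)
qed

abbreviation cantor_square :: "(real \<times> real) set" where
  "cantor_square \<equiv> cantor_set \<times> cantor_set"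

lemma cantor_square_subset_cball: "cantor_square \<subseteq> cball (1/2 :: real, 1/2 :: real) 1"
proof clarify
  fix x y assume "x \<in> cantor_set" "y \<in> cantor_set"
  then have "0 \<le> x * (1 - x)" "0 \<le> y * (1 - y)"
    using cantor_set_bounds by simp_all
  then have "(1/2 - x)\<^sup>2 + (1/2 - y)\<^sup>2 \<le> 1"
    by (simp add: power2_eq_square algebra_simps)
  then show "(x, y) \<in> cball (1/2, 1/2) 1"
    by (simp add: dist_Pair_Pair dist_real_def)
qed

lemma hausdorff_pre_cantor_square_finite:
  assumes "0 < t"
  shows "hausdorff_pre t 2 cantor_square < top"
proof -
  have "hausdorff_pre t 2 cantor_square \<le> hausdorff_pre t 2 (cball (1/2 :: real, 1/2 :: real) 1)"
    by (rule hausdorff_pre_mono[OF cantor_square_subset_cball])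
  also have "\<dots> \<le> ennreal (diameter (cball (1/2 :: real, 1/2 :: real) 1) powr t)"
    by (rule hausdorff_pre_diameter[OF assms bounded_cball])
      (simp_all only: diameter_cball, simp_all)
  also have "\<dots> < top" by simp
  finally show ?thesis .
qed

text \<open>
  The scale \<open>\<delta>\<close> shrinks together with the set. This is why a bound for covers by sets of
  diameter at most \<open>2\<close> turns into a bound for arbitrarily fine covers below.
\<close>

lemma hausdorff_pre_homothety:
  fixes v :: "'a::real_normed_vector"
  assumes "0 < c"
  shows "hausdorff_pre s (c * \<delta>) ((\<lambda>p. v + c *\<^sub>R p) ` E) \<le> ennreal (c powr s) * hausdorff_pre s \<delta> E"
proof (rule hausdorff_pre_similarity[OF _ assms])
  fix x y :: 'a
  have "v + c *\<^sub>R x - (v + c *\<^sub>R y) = c *\<^sub>R (x - y)" by (simp add: scaleR_diff_right)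
  then show "dist (v + c *\<^sub>R x) (v + c *\<^sub>R y) = c * dist x y"
    using assms by (simp add: dist_norm)
qed

lemma hausdorff_pre_contraction:
  fixes v :: "'a::real_normed_vector"
  assumes "0 < c" "c \<le> 1" "0 \<le> \<delta>"
  shows "hausdorff_pre s \<delta> ((\<lambda>p. v + c *\<^sub>R p) ` E) \<le> ennreal (c powr s) * hausdorff_pre s \<delta> E"
  using assms
  by (intro order_trans[OF hausdorff_pre_antimono hausdorff_pre_homothety] mult_left_le_one_le) auto

text \<open>
  One level of the construction replaces the square by four copies of ratio \<open>1/3\<close>, hence the
  factor \<open>4 / 3 powr t\<close> per level. The critical exponent \<open>log 3 4\<close> is where this factor is \<open>1\<close>.
\<close>

lemma hausdorff_pre_cantor_square_rescale:
  assumes t: "0 < t"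
  shows "hausdorff_pre t (2 / 3 ^ m) cantor_square
    \<le> ennreal ((4 / 3 powr t) ^ m) * hausdorff_pre t 2 cantor_square"
proof (induction m)
  case 0 then show ?case by simp
next
  case (Suc m)
  define h where "h = hausdorff_pre t (2 / 3 ^ m) cantor_square"
  let ?I = "{0, 2/3 :: real} \<times> {0, 2/3 :: real}"
  define f where "f v = (\<lambda>p. v + (1/3) *\<^sub>R p)" for v :: "real \<times> real"
  have "cantor_square \<subseteq> (\<Union>v\<in>?I. f v ` cantor_square)"
  proof clarify
    have *: "\<exists>a\<in>{0, 2/3}. \<exists>y\<in>cantor_set. x = a + y / 3" if x: "x \<in> cantor_set" for x
      using cantor_set_cases[OF x]
    proof
      assume "x \<le> 1/3 \<and> 3 * x \<in> cantor_set"
      then show ?thesis by (intro bexI[of _ 0] bexI[of _ "3 * x"]) auto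
    next
      assume "2/3 \<le> x \<and> 3 * x - 2 \<in> cantor_set"
      then show ?thesis
        by (intro bexI[of _ "2/3" "{0, 2/3}"] bexI[of _ "3 * x - 2" cantor_set]) (auto simp: field_simps)
    qed
    fix x y assume "x \<in> cantor_set" "y \<in> cantor_set"
    then obtain a x' b y' where h: "a \<in> {0, 2/3}" "x' \<in> cantor_set" "x = a + x' / 3"
      "b \<in> {0, 2/3}" "y' \<in> cantor_set" "y = b + y' / 3"
      using * by meson
    then have "(x, y) = f (a, b) (x', y')" by (simp add: f_def)
    moreover have "(a, b) \<in> ?I" "(x', y') \<in> cantor_square" using h by auto
    ultimately show "(x, y) \<in> (\<Union>v\<in>?I. f v ` cantor_square)" by blast
  qed
  then have "hausdorff_pre t (2 / 3 ^ Suc m) cantor_square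
      \<le> hausdorff_pre t (2 / 3 ^ Suc m) (\<Union>v\<in>?I. f v ` cantor_square)"
    by (rule hausdorff_pre_mono)
  also have "\<dots> \<le> (\<Sum>v\<in>?I. hausdorff_pre t (2 / 3 ^ Suc m) (f v ` cantor_square))"
    by (rule hausdorff_pre_UN[OF t]) auto
  also have "\<dots> \<le> (\<Sum>v\<in>?I. ennreal ((1/3) powr t) * h)"
  proof (rule sum_mono)
    fix v
    show "hausdorff_pre t (2 / 3 ^ Suc m) (f v ` cantor_square) \<le> ennreal ((1/3) powr t) * h"
      using hausdorff_pre_homothety[of "1/3" t "2 / 3 ^ m" v cantor_square]
      by (simp add: h_def f_def)
  qed
  also have "\<dots> = ennreal (4 / 3 powr t) * h"
  proof -
    have "card ?I = 4" by (simp add: card_cartesian_product)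
    then have "(\<Sum>v\<in>?I. ennreal ((1/3) powr t) * h) = (ennreal 4 * ennreal ((1/3) powr t)) * h"
      by (simp add: mult.assoc)
    also have "ennreal 4 * ennreal ((1/3) powr t) = ennreal (4 / 3 powr t)"
      by (subst ennreal_mult[symmetric]) (auto simp: powr_divide)
    finally show ?thesis .
  qed
  also have "\<dots> \<le> ennreal (4 / 3 powr t) * (ennreal ((4 / 3 powr t) ^ m) * hausdorff_pre t 2 cantor_square)"
    unfolding h_def by (intro mult_left_mono Suc.IH) simp
  also have "\<dots> = ennreal ((4 / 3 powr t) ^ Suc m) * hausdorff_pre t 2 cantor_square"
  proof -
    have "ennreal ((4 / 3 powr t) ^ Suc m) = ennreal (4 / 3 powr t) * ennreal ((4 / 3 powr t) ^ m)"
      unfolding power_Suc by (rule ennreal_mult) auto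
    then show ?thesis by (simp only: mult.assoc)
  qed
  finally show ?case .
qed

lemma hausdorff_pre_le_small_scale:
  assumes "0 < \<delta>"
  shows "\<forall>\<^sub>F m in sequentially. hausdorff_pre t \<delta> E \<le> hausdorff_pre t (2 / 3 ^ m) E"
proof -
  have "(\<lambda>m. 2 / 3 ^ m :: real) \<longlonglongrightarrow> 0"
    using tendsto_mult[OF tendsto_const[of "2::real"] LIMSEQ_power_zero[of "1/3::real"]]
    by (simp add: power_one_over field_simps)
  then have "\<forall>\<^sub>F m in sequentially. 2 / 3 ^ m < \<delta>"
    using assms by (rule order_tendstoD(2))
  then show ?thesis
    by eventually_elim (simp add: hausdorff_pre_antimono)
qed

text \<open>
  At the critical exponent, refining the scale costs nothing, so a single coarse premeasure bounds
  the measure.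
\<close>

lemma hausdorff_measure_cantor_square_le:
  "hausdorff_measure (log 3 4) cantor_square \<le> hausdorff_pre (log 3 4) 2 cantor_square"
  unfolding hausdorff_measure_eq_SUP
proof (rule SUP_least)
  fix \<delta> :: real assume "\<delta> \<in> {0<..}"
  then have "0 < \<delta>" by simp
  then obtain m where "hausdorff_pre (log 3 4) \<delta> cantor_square
      \<le> hausdorff_pre (log 3 4) (2 / 3 ^ m) cantor_square"
    using eventually_happens'[OF sequentially_bot hausdorff_pre_le_small_scale] by blast
  also have "\<dots> \<le> hausdorff_pre (log 3 4) 2 cantor_square"
    using hausdorff_pre_cantor_square_rescale[of "log 3 4" m] by simp
  finally show "hausdorff_pre (log 3 4) \<delta> cantor_square \<le> hausdorff_pre (log 3 4) 2 cantor_square" .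
qed

lemma hausdorff_measure_cantor_square_eq_0:
  assumes t: "log 3 4 < t"
  shows "hausdorff_measure t cantor_square = 0"
proof -
  have t0: "0 < t" using t less_trans[of 0 "log 3 4 :: real" t] by simp
  have "3 powr (log 3 4) < (3::real) powr t" using t by (intro powr_less_mono) auto
  then have q: "4 / 3 powr t < 1" by simp
  obtain h where h: "hausdorff_pre t 2 cantor_square = ennreal h" "0 \<le> h"
    using hausdorff_pre_cantor_square_finite[OF t0] by (cases "hausdorff_pre t 2 cantor_square") auto
  have "(\<lambda>m. (4 / 3 powr t) ^ m * h) \<longlonglongrightarrow> 0 * h"
    by (intro tendsto_mult tendsto_const LIMSEQ_power_zero) (use q in auto)
  then have lim: "(\<lambda>m. ennreal ((4 / 3 powr t) ^ m * h)) \<longlonglongrightarrow> ennreal (0 * h)"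
    by (rule tendsto_ennrealI)
  have "hausdorff_pre t \<delta> cantor_square \<le> 0" if \<delta>: "0 < \<delta>" for \<delta>
  proof (rule tendsto_lowerbound[of _ _ sequentially])
    show "(\<lambda>m. ennreal ((4 / 3 powr t) ^ m * h)) \<longlonglongrightarrow> 0" using lim by simp
    show "\<forall>\<^sub>F m in sequentially. hausdorff_pre t \<delta> cantor_square \<le> ennreal ((4 / 3 powr t) ^ m * h)"
    proof (rule eventually_mono[OF hausdorff_pre_le_small_scale[OF \<delta>]])
      fix m
      assume "hausdorff_pre t \<delta> cantor_square \<le> hausdorff_pre t (2 / 3 ^ m) cantor_square"
      also have "hausdorff_pre t (2 / 3 ^ m) cantor_square \<le> ennreal ((4 / 3 powr t) ^ m) * ennreal h"
        using hausdorff_pre_cantor_square_rescale[OF t0, of m] h by simp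
      also have "\<dots> = ennreal ((4 / 3 powr t) ^ m * h)"
        using h by (intro ennreal_mult[symmetric]) auto
      finally show "hausdorff_pre t \<delta> cantor_square \<le> ennreal ((4 / 3 powr t) ^ m * h)" .
    qed
  qed simp
  then show ?thesis unfolding hausdorff_measure_eq_SUP by (intro antisym SUP_least) auto
qed

section \<open>The Hausdorff dimension\<close>

text \<open>
  The left endpoints of the \<open>2 ^ m\<close> intervals of level \<open>m\<close>. Counting them replaces the natural
  mass distribution on the Cantor set, so that no measure has to be constructed.
\<close>

primrec cantor_endpoints :: "nat \<Rightarrow> real set" where
  "cantor_endpoints 0 = {0}"
| "cantor_endpoints (Suc m) = cantor_map1 ` cantor_endpoints m \<union> cantor_map2 ` cantor_endpoints m"

lemma cantor_endpoints_subset: "cantor_endpoints m \<subseteq> cantor_set"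
  by (induction m) (use zero_in_cantor_set cantor_set_map1 cantor_set_map2 in auto)

lemma cantor_endpoints_bounds: "x \<in> cantor_endpoints m \<Longrightarrow> 0 \<le> x \<and> x \<le> 1"
  using cantor_endpoints_subset cantor_set_bounds by blast

lemma finite_cantor_endpoints: "finite (cantor_endpoints m)"
  by (induction m) auto

lemma cantor_endpoints_gap:
  assumes "x \<in> cantor_map1 ` cantor_endpoints m" "y \<in> cantor_map2 ` cantor_endpoints m"
  shows "1/3 \<le> y - x"
proof -
  obtain u v where "u \<in> cantor_endpoints m" "x = u / 3" "v \<in> cantor_endpoints m" "y = (v + 2) / 3"
    using assms unfolding cantor_map1_def cantor_map2_def by blast
  then show ?thesis
    using cantor_endpoints_bounds[of u m] cantor_endpoints_bounds[of v m] by simp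
qed

lemma card_cantor_endpoints: "card (cantor_endpoints m) = 2 ^ m"
proof (induction m)
  case (Suc m)
  let ?P = "cantor_endpoints m"
  have "cantor_map1 ` ?P \<inter> cantor_map2 ` ?P = {}"
    using cantor_endpoints_gap[of _ m] by fastforce
  moreover have "inj_on cantor_map1 ?P" "inj_on cantor_map2 ?P"
    by (auto simp: inj_on_def cantor_map1_def cantor_map2_def)
  ultimately show ?case
    using Suc.IH by (simp add: card_Un_disjoint finite_cantor_endpoints card_image)
qed simp

text \<open>
  Distinct intervals of level \<open>k\<close> are at least \<open>1 / 3 ^ k\<close> apart, so a set of smaller diameter
  meets only one of them, and that one contains \<open>2 ^ (m - k)\<close> endpoints of level \<open>m\<close>. The
  induction strips off one of the two defining maps at a time.
\<close>

lemma card_cantor_endpoints_close: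
  assumes "A \<subseteq> cantor_endpoints m" "\<And>x y. x \<in> A \<Longrightarrow> y \<in> A \<Longrightarrow> \<bar>x - y\<bar> < 1 / 3 ^ k" "k \<le> m"
  shows "card A \<le> 2 ^ (m - k)"
  using assms
proof (induction k arbitrary: m A)
  case 0
  then show ?case
    using card_mono[OF finite_cantor_endpoints] by (simp add: card_cantor_endpoints)
next
  case (Suc k)
  then obtain n where n: "m = Suc n" "k \<le> n" by (cases m) auto
  let ?P = "cantor_endpoints n"
  have A: "A \<subseteq> cantor_map1 ` ?P \<union> cantor_map2 ` ?P" using Suc.prems(1) n by simp
  have small: "1 / 3 ^ Suc k \<le> (1/3 :: real)" by (simp add: field_simps)
  have "A \<subseteq> cantor_map1 ` ?P \<or> A \<subseteq> cantor_map2 ` ?P"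
  proof (rule ccontr)
    assume "\<not> ?thesis"
    then obtain x y where xy: "x \<in> A" "x \<notin> cantor_map1 ` ?P" "y \<in> A" "y \<notin> cantor_map2 ` ?P"
      by (meson subsetI)
    then have "x \<in> cantor_map2 ` ?P" "y \<in> cantor_map1 ` ?P"
      using A by (meson UnE subsetD)+
    then have "1/3 \<le> x - y"
      using cantor_endpoints_gap[of y n x] by simp
    then show False using Suc.prems(2)[OF xy(1,3)] small by linarith
  qed
  then obtain f where f: "f = cantor_map1 \<or> f = cantor_map2" and Af: "A \<subseteq> f ` ?P" by blast
  then obtain B where B: "B \<subseteq> ?P" "A = f ` B" by (auto simp: subset_image_iff)
  have "card A \<le> card B"
    unfolding B(2) by (rule card_image_le[OF finite_subset[OF B(1) finite_cantor_endpoints]])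
  also have "\<dots> \<le> 2 ^ (n - k)"
  proof (rule Suc.IH[OF B(1) _ n(2)])
    fix x y assume "x \<in> B" "y \<in> B"
    then have "\<bar>f x - f y\<bar> < 1 / 3 ^ Suc k" using Suc.prems(2) B(2) by blast
    moreover have "f x - f y = (x - y) / 3"
      using f by (auto simp: cantor_map1_def cantor_map2_def field_simps)
    ultimately show "\<bar>x - y\<bar> < 1 / 3 ^ k" by (simp add: field_simps)
  qed
  finally show ?case using n by simp
qed

lemma card_square_endpoints_close:
  assumes V: "\<And>p q. p \<in> V \<Longrightarrow> q \<in> V \<Longrightarrow> dist p q < 1 / 3 ^ k" and "k \<le> m"
  shows "card ((cantor_endpoints m \<times> cantor_endpoints m) \<inter> V) \<le> 4 ^ (m - k)"
proof -
  let ?Q = "(cantor_endpoints m \<times> cantor_endpoints m) \<inter> V"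
  have fin: "finite ?Q" using finite_cantor_endpoints by blast
  have "card (fst ` ?Q) \<le> 2 ^ (m - k)"
  proof (rule card_cantor_endpoints_close[OF _ _ \<open>k \<le> m\<close>])
    fix x y assume "x \<in> fst ` ?Q" "y \<in> fst ` ?Q"
    then obtain p q where "p \<in> V" "q \<in> V" "x = fst p" "y = fst q" by blast
    then show "\<bar>x - y\<bar> < 1 / 3 ^ k"
      using V dist_fst_le[of p q] by (fastforce simp: dist_real_def)
  qed auto
  moreover have "card (snd ` ?Q) \<le> 2 ^ (m - k)"
  proof (rule card_cantor_endpoints_close[OF _ _ \<open>k \<le> m\<close>])
    fix x y assume "x \<in> snd ` ?Q" "y \<in> snd ` ?Q"
    then obtain p q where "p \<in> V" "q \<in> V" "x = snd p" "y = snd q" by blast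
    then show "\<bar>x - y\<bar> < 1 / 3 ^ k"
      using V dist_snd_le[of p q] by (fastforce simp: dist_real_def)
  qed auto
  moreover have "card ?Q \<le> card (fst ` ?Q \<times> snd ` ?Q)"
    by (rule card_mono) (use fin in \<open>auto intro: rev_image_eqI\<close>)
  ultimately have "card ?Q \<le> 2 ^ (m - k) * 2 ^ (m - k)"
    unfolding card_cartesian_product by (meson mult_le_mono order_trans)
  then show ?thesis by (simp flip: power_mult_distrib)
qed

lemma ternary_scale:
  fixes d :: real
  assumes "0 < d" "d < 1"
  obtains k where "1 / 3 ^ Suc k \<le> d" "d < 1 / 3 ^ k"
proof -
  define n where "n = (LEAST n. 1 / 3 ^ n \<le> d)"
  obtain n0 where "(1/3) ^ n0 < d" using real_arch_pow_inv[OF assms(1), of "1/3"] by auto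
  then have ex: "1 / 3 ^ n0 \<le> d" by (simp add: power_one_over)
  have n: "1 / 3 ^ n \<le> d" unfolding n_def by (rule LeastI[of "\<lambda>n. 1 / 3 ^ n \<le> d", OF ex])
  then obtain k where k: "n = Suc k" using assms(2) by (cases n) auto
  then have "k < n" by simp
  then have "\<not> 1 / 3 ^ k \<le> d" unfolding n_def by (rule not_less_Least)
  then show thesis using that[of k] n k by simp
qed

text \<open>
  The mass distribution principle in discrete form. A covering set of diameter between
  \<open>1 / 3 ^ Suc k\<close> and \<open>1 / 3 ^ k\<close> contains at most the fraction \<open>1 / 4 ^ k\<close> of the endpoint
  pairs of any finer level, and \<open>1 / 4 ^ k\<close> is at most four times the diameter raised to
  \<open>log 3 4\<close>. Compactness leaves finitely many sets, so one level is fine enough for all of them,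
  and the fractions add up to at least \<open>1\<close>.
\<close>

lemma hausdorff_pre_cantor_square_ge:
  assumes t: "t \<le> log 3 4"
  shows "ennreal (1/4) \<le> hausdorff_pre t (1/2) cantor_square"
proof (rule hausdorff_pre_greatest)
  fix U :: "nat \<Rightarrow> (real \<times> real) set"
  assume cover: "cantor_square \<subseteq> (\<Union>i. U i)" and U: "fine_sets (1/2) U"
  define d where "d i = diameter (U i)" for i
  have d: "0 < d i" "d i < 1" for i
  proof -
    have "0 < d i" "d i \<le> 1/2" using U by (auto simp: d_def)
    then show "0 < d i" "d i < 1" by auto
  qed
  have "\<exists>k. 1 / 3 ^ Suc k \<le> d i \<and> d i < 1 / 3 ^ k" for i
    using ternary_scale[OF d] by metis
  then obtain k where k: "\<And>i. 1 / 3 ^ Suc (k i) \<le> d i" "\<And>i. d i < 1 / 3 ^ k i" by metis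
  \<comment> \<open>The strict inequality for \<open>d i\<close> leaves room to thicken the sets to open ones without
    changing their ternary scale.\<close>
  define e where "e i = (1 / 3 ^ k i - d i) / 3" for i
  have e: "0 < e i" "d i + 2 * e i < 1 / 3 ^ k i" for i
  proof -
    have "3 * e i = 1 / 3 ^ k i - d i" by (simp add: e_def)
    then show "0 < e i" "d i + 2 * e i < 1 / 3 ^ k i" using k(2)[of i] by linarith+
  qed
  define V where "V i = (\<Union>x\<in>U i. ball x (e i))" for i
  have V: "dist p q < 1 / 3 ^ k i" if pq: "p \<in> V i" "q \<in> V i" for p q i
  proof -
    obtain x y where xy: "x \<in> U i" "y \<in> U i" "dist x p < e i" "dist y q < e i"
      using pq by (auto simp: V_def)
    have "dist x y \<le> d i" unfolding d_def
      using U by (intro diameter_bounded_bound xy) auto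
    moreover have "dist p q \<le> dist x p + dist x y + dist y q" by metric
    ultimately show ?thesis using xy e(2)[of i] by linarith
  qed
  have "U i \<subseteq> V i" for i using e(1)[of i] by (auto simp: V_def intro!: bexI)
  then have "(\<Union>i. U i) \<subseteq> (\<Union>i. V i)" by (intro UN_mono) auto
  with cover have coverV: "cantor_square \<subseteq> (\<Union>i. V i)" by (rule order_trans)
  have "compact cantor_square"
    using is_cantor_setD(1)[OF is_cantor_set_cantor_set] by (intro compact_Times)
  moreover have "open (V i)" for i unfolding V_def by blast
  ultimately obtain I where I: "finite I" "cantor_square \<subseteq> (\<Union>i\<in>I. V i)"
    using coverV by (elim compactE_image[of _ UNIV V]) simp_all
  obtain m where m: "\<And>i. i \<in> I \<Longrightarrow> k i \<le> m"
    using finite_nat_set_iff_bounded_le[of "k ` I"] I(1) by auto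
  define Q where "Q = cantor_endpoints m \<times> cantor_endpoints m"
  have "Q \<subseteq> cantor_square" unfolding Q_def using cantor_endpoints_subset by blast
  then have "Q = (\<Union>i\<in>I. Q \<inter> V i)" using I(2) by blast
  moreover have "card Q = 4 ^ m"
    unfolding Q_def card_cartesian_product card_cantor_endpoints by (simp flip: power_mult_distrib)
  ultimately have "4 ^ m \<le> (\<Sum>i\<in>I. card (Q \<inter> V i))"
    using card_UN_le[OF I(1), of "\<lambda>i. Q \<inter> V i"] by simp
  also have "\<dots> \<le> (\<Sum>i\<in>I. 4 ^ (m - k i))"
    unfolding Q_def by (intro sum_mono card_square_endpoints_close V m)
  finally have "real (4 ^ m) \<le> real (\<Sum>i\<in>I. 4 ^ (m - k i))" by (rule of_nat_mono)
  also have "\<dots> = (\<Sum>i\<in>I. 4 ^ m * (1 / 4 ^ k i))"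
    unfolding of_nat_sum of_nat_power of_nat_numeral using m by (simp add: power_diff)
  also have "\<dots> = 4 ^ m * (\<Sum>i\<in>I. 1 / 4 ^ k i)" by (simp only: sum_distrib_left)
  finally have "1 \<le> (\<Sum>i\<in>I. 1 / 4 ^ k i :: real)" by simp
  also have "\<dots> \<le> (\<Sum>i\<in>I. 4 * d i powr t)"
  proof (rule sum_mono)
    fix i
    have "1 / 4 ^ Suc (k i) = (1 / 3 ^ Suc (k i)) powr log 3 (4::real)"
      by (rule powr_log_3_4[symmetric])
    also have "\<dots> \<le> d i powr log 3 4"
      using k(1)[of i] by (intro powr_mono2) auto
    also have "\<dots> \<le> d i powr t"
      using t d[of i] by (intro powr_mono') auto
    finally show "1 / 4 ^ k i \<le> 4 * d i powr t" by simp
  qed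
  finally have "1/4 \<le> (\<Sum>i\<in>I. d i powr t)" by (simp flip: sum_distrib_left)
  then have "ennreal (1/4) \<le> (\<Sum>i\<in>I. ennreal (d i powr t))"
    by (simp add: ennreal_leI)
  also have "\<dots> \<le> (\<Sum>i. ennreal (d i powr t))"
    by (rule sum_le_suminf) (use I(1) in auto)
  finally show "ennreal (1/4) \<le> (\<Sum>i. ennreal (diameter (U i) powr t))" unfolding d_def .
qed

lemma hausdorff_measure_cantor_square_pos:
  assumes "t \<le> log 3 4"
  shows "hausdorff_measure t cantor_square \<noteq> 0"
proof -
  note hausdorff_pre_cantor_square_ge[OF assms]
  also have "hausdorff_pre t (1/2) cantor_square \<le> hausdorff_measure t cantor_square"
    unfolding hausdorff_measure_eq_SUP by (rule SUP_upper) simp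
  finally have "ennreal (1/4) \<le> hausdorff_measure t cantor_square" .
  then show ?thesis by auto
qed

lemma hausdorff_dim_cantor_square: "hausdorff_dim cantor_square = log 3 4"
proof -
  have "{t. 0 \<le> t \<and> hausdorff_measure t cantor_square = 0} = {log 3 4<..}"
  proof (intro set_eqI iffI)
    fix t :: real assume "t \<in> {log 3 4<..}"
    then have t: "log 3 4 < t" by simp
    have "0 < log 3 (4::real)" by simp
    then have "0 < t" using t by (rule less_trans)
    then show "t \<in> {t. 0 \<le> t \<and> hausdorff_measure t cantor_square = 0}"
      using hausdorff_measure_cantor_square_eq_0[OF t] by simp
  qed (use hausdorff_measure_cantor_square_pos not_less in auto)
  then show ?thesis unfolding hausdorff_dim_def by simp
qed

section \<open>The disc with cut corners\<close>

text \<open>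
  The part of the Cantor set to the left of \<open>20/243\<close> consists of the level 3 interval at \<open>0\<close> and
  the level 5 interval at \<open>2/27\<close>; the former is resolved further around its first gap of level 5.
\<close>

lemma cantor_set_near_zero:
  assumes x: "x \<in> cantor_set" "x \<le> 1/2"
  shows "20/243 \<le> x \<or> 2/27 \<le> x \<and> 243 * x - 18 \<in> cantor_set \<or>
    27 * x \<in> cantor_set \<and> (243 * x \<in> cantor_set \<or> 2/243 \<le> x)"
proof -
  have x3: "3 * x \<in> cantor_set" using cantor_set_cases[OF x(1)] x(2) by auto
  consider "20/243 \<le> x" | "9 * x \<in> cantor_set" "9 * x \<le> 1"
    using cantor_set_cases[OF x3] by (force simp: algebra_simps)
  then show ?thesis
  proof cases
    case 2
    consider "27 * x \<in> cantor_set" | "27 * x - 2 \<in> cantor_set" "2/27 \<le> x"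
      using cantor_set_cases[OF 2(1)] by (auto simp: algebra_simps)
    then show ?thesis
    proof cases
      case a: 1
      consider "81 * x \<in> cantor_set" | "2/243 \<le> x"
        using cantor_set_cases[OF a] by (auto simp: algebra_simps)
      then show ?thesis
        using a cantor_set_cases[of "81 * x"] by cases (auto simp: algebra_simps)
    next
      case b: 2
      consider "81 * x - 6 \<in> cantor_set" | "20/243 \<le> x"
        using cantor_set_cases[OF b(1)] by (auto simp: algebra_simps)
      then show ?thesis
        using b(2) cantor_set_cases[of "81 * x - 6"] by cases (auto simp: algebra_simps)
    qed
  qed auto
qed

text \<open>
  The cells cut off at the corner \<open>(0, 0)\<close>: one cell of level 3 and, next to it along the two
  sides, one cell of level 5 each.
\<close>

definition corner_cells :: "(real \<times> real) set" where
  "corner_cells =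
     (\<lambda>p. (0, 0) + (1/27) *\<^sub>R p) ` cantor_square \<union>
     ((\<lambda>p. (2/27, 0) + (1/243) *\<^sub>R p) ` cantor_square \<union>
      (\<lambda>p. (0, 2/27) + (1/243) *\<^sub>R p) ` cantor_square)"

text \<open>
  The radius is chosen so that the circle passes through \<open>(20/243, 0)\<close>, whose offset from the
  centre is \<open>(203/486, 243/486)\<close>, and \<open>203\<^sup>2 + 243\<^sup>2 = 100258\<close>. Among the points of
  the product of the Cantor set with itself that have both coordinates at most \<open>1/2\<close> and lie outside
  the corner cells, this one and its mirror image are farthest from the centre.
\<close>

lemma cantor_square_corner:
  assumes x: "x \<in> cantor_set" "x \<le> 1/2" and y: "y \<in> cantor_set" "y \<le> 1/2"
  shows "(x, y) \<in> corner_cells \<or> (1/2 - x)\<^sup>2 + (1/2 - y)\<^sup>2 \<le> 100258 / 486\<^sup>2"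
proof -
  have sq: "(1/2 - z)\<^sup>2 \<le> (1/2 - a)\<^sup>2" if "a \<le> z" "z \<le> 1/2" for a z :: real
    using that by (intro power_mono) auto
  have x0: "0 \<le> x" and y0: "0 \<le> y" using x y cantor_set_bounds by auto
  have big: "27 * x \<in> cantor_set \<and> 27 * y \<in> cantor_set \<Longrightarrow> (x, y) \<in> corner_cells"
    unfolding corner_cells_def by (intro UnI1 image_eqI[of _ _ "(27 * x, 27 * y)"]) auto
  have right: "243 * x - 18 \<in> cantor_set \<and> 243 * y \<in> cantor_set \<Longrightarrow> (x, y) \<in> corner_cells"
    unfolding corner_cells_def
    by (intro UnI2 UnI1 image_eqI[of _ _ "(243 * x - 18, 243 * y)"]) (auto simp: field_simps)
  have up: "243 * x \<in> cantor_set \<and> 243 * y - 18 \<in> cantor_set \<Longrightarrow> (x, y) \<in> corner_cells"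
    unfolding corner_cells_def
    by (intro UnI2 image_eqI[of _ _ "(243 * x, 243 * y - 18)"]) (auto simp: field_simps)
  have far: "(1/2 - x)\<^sup>2 + (1/2 - y)\<^sup>2 \<le> 100258 / 486\<^sup>2"
    if "a \<le> x" "b \<le> y" "(1/2 - a)\<^sup>2 + (1/2 - b)\<^sup>2 \<le> 100258 / 486\<^sup>2" for a b
    using sq[of a x] sq[of b y] that x(2) y(2) by linarith
  have far1: "20/243 \<le> x \<Longrightarrow> (1/2 - x)\<^sup>2 + (1/2 - y)\<^sup>2 \<le> 100258 / 486\<^sup>2"
    by (rule far[of "20/243" 0, OF _ y0]) (auto simp: power2_eq_square)
  have far2: "20/243 \<le> y \<Longrightarrow> (1/2 - x)\<^sup>2 + (1/2 - y)\<^sup>2 \<le> 100258 / 486\<^sup>2"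
    by (rule far[of 0 "20/243", OF x0]) (auto simp: power2_eq_square)
  have far3: "2/27 \<le> x \<Longrightarrow> 2/243 \<le> y \<Longrightarrow> (1/2 - x)\<^sup>2 + (1/2 - y)\<^sup>2 \<le> 100258 / 486\<^sup>2"
    by (rule far[of "2/27" "2/243"]) (auto simp: power2_eq_square)
  have far4: "2/243 \<le> x \<Longrightarrow> 2/27 \<le> y \<Longrightarrow> (1/2 - x)\<^sup>2 + (1/2 - y)\<^sup>2 \<le> 100258 / 486\<^sup>2"
    by (rule far[of "2/243" "2/27"]) (auto simp: power2_eq_square)
  have far5: "2/27 \<le> x \<Longrightarrow> 2/27 \<le> y \<Longrightarrow> (1/2 - x)\<^sup>2 + (1/2 - y)\<^sup>2 \<le> 100258 / 486\<^sup>2"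
    by (rule far[of "2/27" "2/27"]) (auto simp: power2_eq_square)
  show ?thesis
    using cantor_set_near_zero[OF x] cantor_set_near_zero[OF y]
      big right up far1 far2 far3 far4 far5 by argo
qed

definition reflect_coords :: "bool \<times> bool \<Rightarrow> real \<times> real \<Rightarrow> real \<times> real" where
  "reflect_coords b p =
     (if fst b then 1 - fst p else fst p, if snd b then 1 - snd p else snd p)"

lemma dist_reflect_coords: "dist (reflect_coords b p) (reflect_coords b q) = dist p q"
  by (cases p; cases q) (auto simp: reflect_coords_def dist_Pair_Pair dist_real_def power2_commute)

definition truncating_disc :: "(real \<times> real) set" where
  "truncating_disc = cball (1/2, 1/2) (sqrt 100258 / 486)"

lemma cantor_square_subset:
  "cantor_square \<subseteq> truncating_disc \<union> (\<Union>b\<in>UNIV. reflect_coords b ` corner_cells)"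
proof clarify
  fix x y assume xy: "x \<in> cantor_set" "y \<in> cantor_set"
    and notin: "(x, y) \<notin> (\<Union>b\<in>UNIV. reflect_coords b ` corner_cells)"
  define b where "b = (1/2 < x, 1/2 < y)"
  obtain x' y' where r: "reflect_coords b (x, y) = (x', y')" by fastforce
  have unreflect: "reflect_coords b (x', y') = (x, y)"
    using r by (auto simp: reflect_coords_def)
  have "x' \<in> cantor_set" "x' \<le> 1/2" "y' \<in> cantor_set" "y' \<le> 1/2"
    using r xy cantor_set_reflect by (auto simp: reflect_coords_def b_def)
  moreover have "(x', y') \<notin> corner_cells"
    using notin unreflect by (metis UN_I UNIV_I image_eqI)
  ultimately have "(1/2 - x')\<^sup>2 + (1/2 - y')\<^sup>2 \<le> 100258 / 486\<^sup>2"
    using cantor_square_corner by blast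
  moreover have "(1/2 - x')\<^sup>2 = (1/2 - x)\<^sup>2" "(1/2 - y')\<^sup>2 = (1/2 - y)\<^sup>2"
    unfolding power2_eq_iff using r by (auto simp: reflect_coords_def split: if_splits)
  ultimately have "(1/2 - x)\<^sup>2 + (1/2 - y)\<^sup>2 \<le> 100258 / 486\<^sup>2"
    by simp
  then have "sqrt ((1/2 - x)\<^sup>2 + (1/2 - y)\<^sup>2) \<le> sqrt (100258 / 486\<^sup>2)"
    by (rule real_sqrt_le_mono)
  also have "\<dots> = sqrt 100258 / 486"
    unfolding real_sqrt_divide real_sqrt_abs by simp
  finally show "(x, y) \<in> truncating_disc"
    by (simp add: truncating_disc_def dist_Pair_Pair dist_real_def)
qed

text \<open>
  Cells of level 3 and 5 carry the fractions \<open>1/64\<close> and \<open>1/1024\<close>, and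
  \<open>1/64 + 2/1024 = 9/512\<close>.
\<close>

lemma hausdorff_pre_corner_cells:
  "hausdorff_pre (log 3 4) 2 (reflect_coords b ` corner_cells)
    \<le> ennreal (9/512) * hausdorff_pre (log 3 4) 2 cantor_square"
proof -
  let ?H = "hausdorff_pre (log 3 4) 2"
  have s: "0 < log 3 (4::real)" by simp
  have small: "?H ((\<lambda>p. v + (1 / 3 ^ k) *\<^sub>R p) ` cantor_square) \<le> ennreal (1 / 4 ^ k) * ?H cantor_square"
    for v k
    using hausdorff_pre_contraction[of "1 / 3 ^ k" 2 "log 3 4" v cantor_square]
    by (simp add: powr_log_3_4)
  have "?H (reflect_coords b ` corner_cells) \<le> ?H corner_cells"
    using hausdorff_pre_similarity[of "reflect_coords b" 1 "log 3 4" 2 corner_cells]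
    by (simp add: dist_reflect_coords)
  also have "\<dots> \<le> ?H ((\<lambda>p. (0, 0) + (1/27) *\<^sub>R p) ` cantor_square) +
      (?H ((\<lambda>p. (2/27, 0) + (1/243) *\<^sub>R p) ` cantor_square) +
       ?H ((\<lambda>p. (0, 2/27) + (1/243) *\<^sub>R p) ` cantor_square))"
    unfolding corner_cells_def
    by (intro order_trans[OF hausdorff_pre_Un[OF s]] add_left_mono) auto
  also have "\<dots> \<le> ennreal (1/64) * ?H cantor_square +
      (ennreal (1/1024) * ?H cantor_square + ennreal (1/1024) * ?H cantor_square)"
    using small[of _ 3] small[of _ 5] by (intro add_mono) simp_all
  also have "\<dots> = (ennreal (1/64) + (ennreal (1/1024) + ennreal (1/1024))) * ?H cantor_square"
    by (simp only: distrib_right)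
  also have "ennreal (1/64) + (ennreal (1/1024) + ennreal (1/1024)) = ennreal (9/512)"
    by (simp flip: ennreal_plus)
  finally show ?thesis .
qed

text \<open>
  \<open>53/84\<close> is a convergent of the continued fraction of \<open>log 3 2\<close>; its error of about
  \<open>2 / 10^5\<close> fits into the margin of the final estimate.
\<close>

lemma log_3_2_le: "log 3 2 \<le> (53/84 :: real)"
proof -
  have "(2::real) ^ 84 \<le> 3 ^ 53" by simp
  then have "log 3 ((2::real) ^ 84) \<le> log 3 (3 ^ 53)" by (subst log_le_cancel_iff) auto
  then have "84 * log 3 (2::real) \<le> 53 * log 3 3"
    by (simp only: log_nat_power of_nat_numeral zero_less_numeral)
  then show ?thesis by simp
qed

lemma diameter_truncating_disc: "diameter truncating_disc = sqrt 100258 / 243"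
  unfolding truncating_disc_def diameter_cball by simp

lemma diameter_truncating_disc_powr: "diameter truncating_disc powr log 3 4 \<le> 1.3967"
proof -
  have "log 3 ((2::real)\<^sup>2) = 2 * log 3 2" by (subst log_nat_power) auto
  then have s: "log 3 4 = 2 * log 3 (2::real)" by simp
  have "(sqrt 100258 / 243) powr log 3 4 = ((sqrt 100258 / 243) powr 2) powr log 3 2"
    unfolding s powr_powr ..
  also have "(sqrt 100258 / 243) powr 2 = 100258 / (59049 :: real)"
    by (simp add: powr_numeral power_divide)
  also have "(100258 / 59049 :: real) powr log 3 2 \<le> (100258 / 59049) powr (53/84)"
    by (rule powr_mono[OF log_3_2_le]) simp
  also have "\<dots> \<le> 1.6979 powr (53/84)"
    by (rule powr_mono2) auto
  also have "\<dots> \<le> 1.3967"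
  proof (rule power_le_imp_le_base)
    have "(1.6979 powr (53/84) :: real) ^ 84 = (1.6979 powr (53/84)) powr 84"
      by (simp add: powr_numeral)
    also have "\<dots> = 1.6979 powr 53" by (simp only: powr_powr) simp
    also have "\<dots> = 1.6979 ^ 53" by (simp add: powr_numeral)
    also have "\<dots> \<le> (1.3967 :: real) ^ 84" by (simp add: power_divide field_simps)
    finally show "(1.6979 powr (53/84) :: real) ^ Suc 83 \<le> 1.3967 ^ Suc 83" by simp
  qed simp
  finally show ?thesis unfolding diameter_truncating_disc .
qed

text \<open>
  The cells outside the disc are small copies of the whole set, so the premeasure \<open>h\<close> satisfies
  \<open>h \<le> 1.3967 + 9/128 * h\<close>. Since \<open>h\<close> is finite, this can be solved for \<open>h\<close>.
\<close>

lemma hausdorff_pre_cantor_square_le: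
  "hausdorff_pre (log 3 4) 2 cantor_square \<le> ennreal 1.502483"
proof -
  let ?H = "hausdorff_pre (log 3 4) 2"
  have s: "0 < log 3 (4::real)" by simp
  obtain h where h: "?H cantor_square = ennreal h" "0 \<le> h"
    using hausdorff_pre_cantor_square_finite[OF s] by (cases "?H cantor_square") auto
  have "sqrt 100258 \<le> sqrt (486\<^sup>2)" by (subst real_sqrt_le_iff) simp
  then have d: "diameter truncating_disc \<le> 2" "0 < diameter truncating_disc"
    by (simp_all add: diameter_truncating_disc)
  have "?H truncating_disc \<le> ennreal (diameter truncating_disc powr log 3 4)"
    using d by (intro hausdorff_pre_diameter s) (simp_all add: truncating_disc_def)
  also have "\<dots> \<le> ennreal 1.3967" by (intro ennreal_leI diameter_truncating_disc_powr)
  finally have disc: "?H truncating_disc \<le> ennreal 1.3967" .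
  have "?H cantor_square \<le> ?H (truncating_disc \<union> (\<Union>b\<in>UNIV. reflect_coords b ` corner_cells))"
    by (rule hausdorff_pre_mono[OF cantor_square_subset])
  also have "\<dots> \<le> ?H truncating_disc + ?H (\<Union>b\<in>UNIV. reflect_coords b ` corner_cells)"
    by (rule hausdorff_pre_Un[OF s]) simp
  also have "\<dots> \<le> ennreal 1.3967 + (\<Sum>b\<in>UNIV. ?H (reflect_coords b ` corner_cells))"
    by (intro add_mono disc hausdorff_pre_UN s) auto
  also have "\<dots> \<le> ennreal 1.3967 + (\<Sum>b::bool \<times> bool\<in>UNIV. ennreal (9/512 * h))"
    using hausdorff_pre_corner_cells h(2)
    by (intro add_left_mono sum_mono) (simp only: h(1) ennreal_mult[OF _ h(2)])
  also have "\<dots> = ennreal (1.3967 + 4 * (9/512 * h))"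
  proof -
    have "(\<Sum>b::bool \<times> bool\<in>UNIV. ennreal (9/512 * h)) = ennreal 4 * ennreal (9/512 * h)"
      by (simp add: card_cartesian_product flip: UNIV_Times_UNIV)
    also have "\<dots> = ennreal (4 * (9/512 * h))"
      using h(2) by (intro ennreal_mult[symmetric]) auto
    finally show ?thesis using h(2) by (simp only:) (rule ennreal_plus[symmetric], auto)
  qed
  finally have "h \<le> 1.3967 + 4 * (9/512 * h)"
    unfolding h(1) by (subst (asm) ennreal_le_iff) (use h(2) in auto)
  then show ?thesis unfolding h(1) by (intro ennreal_leI) simp
qed

theorem mainTheorem1:
  fixes s :: real
  assumes "s = hausdorff_dim (cantor_set \<times> cantor_set)"
  shows "s = log 3 4 \<and>
         hausdorff_measure s (cantor_set \<times> cantor_set) \<le> ennreal 1.502483"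
proof
  show s: "s = log 3 4" using assms hausdorff_dim_cantor_square by simp
  show "hausdorff_measure s (cantor_set \<times> cantor_set) \<le> ennreal 1.502483"
    unfolding s by (rule order_trans[OF hausdorff_measure_cantor_square_le hausdorff_pre_cantor_square_le])
qed

end
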